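(* Let $k\ge 1$ and $n\ge 1$ be integers. The distribution of each of the statistics $\mathrm{pk}_0,\mathrm{pk}_1,\dots,\mathrm{pk}_{k-1},\mathrm{dd}$ on $\mathcal{P}^k_n$ is the reversed distribution of $\mathrm{pk}$ on $\mathcal{P}^k_n$; that is, for every $\mathrm{st}\in\{\mathrm{pk}_0,\dots,\mathrm{pk}_{k-1},\mathrm{dd}\}$ and every integer $r$ with $0\le r\le n-1$, the number of $P\in\mathcal{P}^k_n$ with $\mathrm{st}(P)=r$ equals the number of $P\in\mathcal{P}^k_n$ with $\mathrm{pk}(P)=n-1-r$.
   Context: A $k$-Dyck path of down-size $n$ is a lattice path from $(0,0)$ to $((k+1)n,0)$ with steps $u=(1,1)$ and $d=(1,-k)$ that stays in the first quadrant (never goes below the $x$-axis). $\mathcal{P}^k_n$ is the set of all such paths. A peak is a block of two consecutive steps $ud$; its height is the second coordinate of the left endpoint of its $d$ step. A double descent is a block $dd$ of two consecutive steps. $\mathrm{pk}(P)$ is the number of non-rightmost peaks of $P$ (the number of all peaks minus one). For $0\le i\le k-1$, $\mathrm{pk}_i(P)$ is the number of non-rightmost peaks of $P$ whose height is congruent to $i$ modulo $k$; $\mathrm{dd}(P)$ is the number of double descents of $P$. *)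

theory Defs
  imports Main "HOL-Library.Product_Plus" "HOL-Number_Theory.Cong"
begin

datatype step = U | D

fun step_vec :: "nat \<Rightarrow> step \<Rightarrow> int \<times> int" where
  "step_vec k U = (1, 1)"
| "step_vec k D = (1, - int k)"

text \<open>A lattice path starting at the origin is given by its list of steps;
  \<open>vertex k P j\<close> is the lattice point reached after the first \<open>j\<close> steps.\<close>

definition vertex :: "nat \<Rightarrow> step list \<Rightarrow> nat \<Rightarrow> int \<times> int" where
  "vertex k P j = (\<Sum>s\<leftarrow>take j P. step_vec k s)"

definition dyck_paths :: "nat \<Rightarrow> nat \<Rightarrow> step list set" where
  "dyck_paths k n =
     {P. vertex k P (length P) = (int ((k + 1) * n), 0) \<and>
         (\<forall>j\<le>length P. 0 \<le> fst (vertex k P j) \<and> 0 \<le> snd (vertex k P j))}"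

text \<open>A block of two consecutive steps is represented by the list index of its first step.\<close>

definition peaks :: "step list \<Rightarrow> nat set" where
  "peaks P = {j. Suc j < length P \<and> P ! j = U \<and> P ! Suc j = D}"

definition peak_height :: "nat \<Rightarrow> step list \<Rightarrow> nat \<Rightarrow> int" where
  "peak_height k P j = snd (vertex k P (Suc j))"

definition nonrightmost_peaks :: "step list \<Rightarrow> nat set" where
  "nonrightmost_peaks P = {j \<in> peaks P. \<exists>j'\<in>peaks P. j < j'}"

definition pk :: "step list \<Rightarrow> nat" where
  "pk P = card (nonrightmost_peaks P)"

definition pk_mod :: "nat \<Rightarrow> nat \<Rightarrow> step list \<Rightarrow> nat" where
  "pk_mod k i P = card {j \<in> nonrightmost_peaks P. [peak_height k P j = int i] (mod int k)}"

definition dd :: "step list \<Rightarrow> nat" where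
  "dd P = card {j. Suc j < length P \<and> P ! j = D \<and> P ! Suc j = D}"

end

theory Submission
  imports Defs
begin

text \<open>
  A \<open>k\<close>-Dyck path of down-size \<open>n\<close> factors uniquely as \<open>Q\<^sub>0 U Q\<^sub>1 U \<dots> U Q\<^sub>k D\<close> with \<open>k\<close>-Dyck
  paths \<open>Q\<^sub>j\<close> starting at relative height \<open>j\<close>, so paths correspond to trees with \<open>n\<close> inner nodes
  in which every inner node has \<open>k + 1\<close> children (\<open>bij_betw_path_tree\<close>).

  A double descent is an inner node whose child \<open>Q\<^sub>k\<close> is not a leaf. Every non-rightmost peak is
  followed by exactly one valley \<open>DU\<close>, whose height is the same modulo \<open>k\<close>. A valley is a
  non-leaf child \<open>Q\<^sub>j\<close> with \<open>j < k\<close>, and its height is \<open>j\<close> plus the height at which the factor of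
  the parent starts. So \<open>pk_mod k i\<close> counts, over all inner nodes, the non-leaf children in one of
  the slots \<open>0, \<dots>, k - 1\<close>, which is determined by \<open>i\<close> and the starting height of the node.
  Exchanging this slot with slot \<open>k\<close> at every node permutes the trees and carries \<open>pk_mod k i\<close>
  to \<open>dd\<close> (\<open>descents_twist\<close>, \<open>bij_betw_twist\<close>, \<open>card_pk_mod_eq_card_dd\<close>). Finally, each down
  step except the last is followed by an up step or a down step, which gives
  \<open>dd P + pk P = n - 1\<close> for every path (\<open>dyck_path_statistics\<close>).
\<close>

section \<open>Dyck paths as trees\<close>

text \<open>Ordered trees. The children of a node are listed from the last factor to the first, so a
  node \<open>Node [Q\<^sub>k, \<dots>, Q\<^sub>0]\<close> stands for the path \<open>Q\<^sub>0 U Q\<^sub>1 U \<dots> U Q\<^sub>k D\<close>, and a leaf for the empty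
  path.\<close>

datatype tree = Leaf | Node "tree list"

text \<open>Postfix notation: the code of the tree of a path \<open>P\<close> is \<open>U # P\<close>.\<close>

fun code :: "tree \<Rightarrow> step list" where
  "code Leaf = [U]"
| "code (Node ts) = concat (map code (rev ts)) @ [D]"

text \<open>One step of the stack machine that evaluates postfix notation. The head of the list is the
  top of the stack. At height \<open>h\<close> of the path the stack has \<open>h + 1\<close> entries.\<close>

fun tree_step :: "nat \<Rightarrow> tree list \<Rightarrow> step \<Rightarrow> tree list" where
  "tree_step k st U = Leaf # st"
| "tree_step k st D = Node (take (Suc k) st) # drop (Suc k) st"

text \<open>Every inner node has exactly \<open>k + 1\<close> children.\<close>

fun wf_tree :: "nat \<Rightarrow> tree \<Rightarrow> bool" where
  "wf_tree k Leaf = True"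
| "wf_tree k (Node ts) = (length ts = Suc k \<and> (\<forall>t\<in>set ts. wf_tree k t))"

fun nodes :: "tree \<Rightarrow> nat" where
  "nodes Leaf = 0"
| "nodes (Node ts) = Suc (sum_list (map nodes ts))"

definition trees :: "nat \<Rightarrow> nat \<Rightarrow> tree set" where
  "trees k n = {t. wf_tree k t \<and> nodes t = n}"

text \<open>Started with a stack of size \<open>s\<close>, the machine reads the word without underflow and ends with
  exactly one tree.\<close>

fun stack_ok :: "nat \<Rightarrow> nat \<Rightarrow> step list \<Rightarrow> bool" where
  "stack_ok k s [] = (s = 1)"
| "stack_ok k s (U # w) = stack_ok k (Suc s) w"
| "stack_ok k s (D # w) = (Suc k \<le> s \<and> stack_ok k (s - k) w)"

lemma foldl_code: "wf_tree k t \<Longrightarrow> foldl (tree_step k) st (code t) = t # st"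
proof (induction t arbitrary: st)
  case (Node ts)
  have *: "foldl (tree_step k) st (concat (map code us)) = rev us @ st"
    if "set us \<subseteq> set ts" for us st
    using that Node by (induction us arbitrary: st) auto
  have "foldl (tree_step k) st (concat (map code (rev ts))) = ts @ st"
    using *[of "rev ts"] by simp
  then show ?case using Node.prems by simp
qed simp

lemma stack_ok_code: "wf_tree k t \<Longrightarrow> stack_ok k s (code t @ w) = stack_ok k (Suc s) w"
proof (induction t arbitrary: s w)
  case (Node ts)
  have *: "stack_ok k s (concat (map code us) @ w) = stack_ok k (s + length us) w"
    if "set us \<subseteq> set ts" for us s w
    using that Node by (induction us arbitrary: s) auto
  show ?case using *[of "rev ts" s "D # w"] Node.prems by (simp add: Suc_diff_le)
qed simp

text \<open>The equation for \<open>code t\<close> makes the evaluation of words injective.\<close>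

lemma foldl_tree_step:
  assumes "stack_ok k (length st) w" "\<forall>t\<in>set st. wf_tree k t"
  shows "\<exists>t. foldl (tree_step k) st w = [t] \<and> wf_tree k t \<and>
           code t = concat (map code (rev st)) @ w \<and>
           nodes t = sum_list (map nodes st) + count_list w D"
  using assms
proof (induction w arbitrary: st)
  case Nil
  then show ?case by (auto simp: length_Suc_conv)
next
  case (Cons s w)
  show ?case
  proof (cases s)
    case U
    then show ?thesis using Cons.IH[of "Leaf # st"] Cons.prems by auto
  next
    case D
    define xs ys where "xs = take (Suc k) st" and "ys = drop (Suc k) st"
    have st: "st = xs @ ys" by (simp add: xs_def ys_def)
    have len: "length xs = Suc k" using Cons.prems D by (simp add: xs_def)
    have s: "tree_step k st s = Node xs # ys" by (simp add: D xs_def ys_def)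
    show ?thesis
      using Cons.IH[of "Node xs # ys"] Cons.prems unfolding s foldl.simps
      by (auto simp: st len D Suc_diff_le)
  qed
qed

lemma stack_ok_iff:
  "(int s - 1 + snd (vertex k P (length P)) = 0 \<and>
    (\<forall>j\<le>length P. 0 \<le> int s - 1 + snd (vertex k P j))) \<longleftrightarrow> stack_ok k s P" if "s \<ge> 1"
  using that
proof (induction P arbitrary: s)
  case Nil
  then show ?case by (auto simp: vertex_def)
next
  case (Cons a P)
  have v: "vertex k (a # P) (Suc j) = step_vec k a + vertex k P j" for a P j
    by (simp add: vertex_def)
  have v0: "vertex k P 0 = 0" for P by (simp add: vertex_def)
  have all: "(\<forall>j\<le>length (a # P). Q j) \<longleftrightarrow> Q 0 \<and> (\<forall>j\<le>length P. Q (Suc j))" for Q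
    by (metis Suc_le_mono bot_nat_0.extremum length_Cons not0_implies_Suc)
  show ?case
  proof (cases a)
    case U
    then show ?thesis using Cons.IH[of "Suc s"] Cons.prems
      unfolding all by (simp add: v v0 algebra_simps)
  next
    case D
    show ?thesis
    proof (cases "Suc k \<le> s")
      case True
      then show ?thesis using D Cons.IH[of "s - k"] Cons.prems
        unfolding all by (simp add: v v0 algebra_simps of_nat_diff)
    next
      case False
      have "\<exists>j\<le>length P. int s - 1 + snd (vertex k (a # P) (Suc j)) < 0"
        by (rule exI[of _ 0]) (use D False in \<open>simp add: v v0\<close>)
      then show ?thesis using D False unfolding all by (auto simp: not_le)
    qed
  qed
qed

lemma vertex_length:
  "fst (vertex k P j) = int (length (take j P))"
  "vertex k P (length P) = (int (length P), int (length P) - int (Suc k) * int (count_list P D))"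
proof -
  have *: "(\<Sum>s\<leftarrow>P. step_vec k s) =
      (int (length P), int (length P) - int (Suc k) * int (count_list P D))" for P
  proof (induction P)
    case (Cons a P)
    then show ?case by (cases a) (auto simp: algebra_simps)
  qed (simp add: zero_prod_def)
  show "fst (vertex k P j) = int (length (take j P))"
    unfolding vertex_def * by simp
  show "vertex k P (length P) = (int (length P), int (length P) - int (Suc k) * int (count_list P D))"
    unfolding vertex_def by (simp add: *)
qed

lemma dyck_paths_iff: "P \<in> dyck_paths k n \<longleftrightarrow> stack_ok k 1 P \<and> count_list P D = n"
proof -
  have ok: "stack_ok k 1 P \<longleftrightarrow>
      snd (vertex k P (length P)) = 0 \<and> (\<forall>j\<le>length P. 0 \<le> snd (vertex k P j))"
    using stack_ok_iff[of 1 k P] by simp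
  have "fst (vertex k P (length P)) = int ((k + 1) * n) \<longleftrightarrow> length P = Suc k * n"
    unfolding vertex_length(1) by (simp flip: of_nat_mult of_nat_add)
  then have "P \<in> dyck_paths k n \<longleftrightarrow> stack_ok k 1 P \<and> length P = Suc k * n"
    unfolding dyck_paths_def mem_Collect_eq ok prod_eq_iff fst_conv snd_conv
    by (auto simp: vertex_length(1))
  moreover have "length P = Suc k * count_list P D" if "stack_ok k 1 P"
  proof -
    have "int (length P) = int (Suc k * count_list P D)"
      using that unfolding ok vertex_length(2) of_nat_mult by simp
    then show ?thesis by (simp only: of_nat_eq_iff)
  qed
  ultimately show ?thesis by (metis mult_cancel1 old.nat.distinct(2))
qed

lemma finite_dyck_paths: "finite (dyck_paths k n)"
proof (rule finite_subset)
  show "dyck_paths k n \<subseteq> {P. set P \<subseteq> {U, D} \<and> length P = (k + 1) * n}"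
  proof
    fix P assume "P \<in> dyck_paths k n"
    then have "fst (vertex k P (length P)) = int ((k + 1) * n)" by (simp add: dyck_paths_def)
    then have "length P = (k + 1) * n" 
      unfolding vertex_length(1) by (simp only: take_all order_refl of_nat_eq_iff)
    then show "P \<in> {P. set P \<subseteq> {U, D} \<and> length P = (k + 1) * n}"
      using step.exhaust by blast
  qed
qed (simp add: finite_lists_length_eq)

text \<open>The virtual initial up step of the code puts one leaf on the stack.\<close>

definition path_tree :: "nat \<Rightarrow> step list \<Rightarrow> tree" where
  "path_tree k P = hd (foldl (tree_step k) [Leaf] P)"

lemma path_tree:
  assumes "P \<in> dyck_paths k n"
  shows "foldl (tree_step k) [Leaf] P = [path_tree k P]"
    "path_tree k P \<in> trees k n" "code (path_tree k P) = U # P"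
  using foldl_tree_step[of k "[Leaf]" P] assms
  by (auto simp: dyck_paths_iff path_tree_def trees_def)

lemma bij_betw_path_tree: "bij_betw (path_tree k) (dyck_paths k n) (trees k n)"
proof (rule bij_betw_byWitness[where f' = "\<lambda>t. tl (code t)"])
  have *: "tl (code t) \<in> dyck_paths k n \<and> path_tree k (tl (code t)) = t" if "t \<in> trees k n" for t
  proof -
    have wf: "wf_tree k t" and n: "nodes t = n" using that by (auto simp: trees_def)
    have ok: "stack_ok k 0 (code t)" using stack_ok_code[OF wf, of 0 "[]"] by simp
    then obtain P where P: "code t = U # P"
      using stack_ok.elims(2)[of k 0 "code t"] by auto
    have fold: "foldl (tree_step k) [Leaf] P = [t]"
      using foldl_code[OF wf, of "[]"] by (simp add: P)
    have "stack_ok k 1 P" using ok by (simp add: P)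
    then show ?thesis
      using foldl_tree_step[of k "[Leaf]" P] fold n
      by (auto simp: P dyck_paths_iff path_tree_def)
  qed
  then show "\<forall>t\<in>trees k n. path_tree k (tl (code t)) = t"
    "(\<lambda>t. tl (code t)) ` trees k n \<subseteq> dyck_paths k n" by auto
qed (auto simp: path_tree)

section \<open>The statistics on words\<close>

text \<open>The number of valleys \<open>DU\<close> whose height satisfies \<open>Q\<close>, in a word that starts at height
  \<open>h\<close>; the flag says whether the preceding step is a down step.\<close>

fun valleys :: "nat \<Rightarrow> (int \<Rightarrow> bool) \<Rightarrow> int \<Rightarrow> bool \<Rightarrow> step list \<Rightarrow> nat" where
  "valleys k Q h b [] = 0"
| "valleys k Q h b (U # w) = of_bool (b \<and> Q h) + valleys k Q (h + 1) False w"
| "valleys k Q h b (D # w) = valleys k Q (h - int k) True w"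

text \<open>The number of double descents, with the same convention for the flag.\<close>

fun descents :: "bool \<Rightarrow> step list \<Rightarrow> nat" where
  "descents b [] = 0"
| "descents b (U # w) = descents False w"
| "descents b (D # w) = of_bool b + descents True w"

lemma valleys_descents:
  assumes "last ((if b then D else U) # w) = D"
  shows "valleys k (\<lambda>_. True) h b w + descents b w + 1 = count_list w D + of_bool b"
  using assms
proof (induction w arbitrary: b h)
  case (Cons s w)
  show ?case
    using Cons.IH[of False "h + 1"] Cons.IH[of True "h - int k"] Cons.prems
    by (cases s) (auto split: if_splits)
qed (auto split: if_splits)

lemma card_positions_Cons:
  "finite {j. A (Suc j)} \<Longrightarrow> card {j. A j} = of_bool (A 0) + card {j::nat. A (Suc j)}"
proof -
  assume fin: "finite {j. A (Suc j)}"
  have "{j. A j} = (if A 0 then {0} else {}) \<union> Suc ` {j. A (Suc j)}"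
    using not0_implies_Suc by (auto simp: image_iff) (metis not0_implies_Suc)+
  then show ?thesis using fin by (auto simp: card_image card_insert_if)
qed

lemma dd_Cons: "dd (s # w) = of_bool (s = D \<and> w \<noteq> [] \<and> hd w = D) + dd w"
proof -
  have "finite {j. Suc j < length w \<and> w ! j = D \<and> w ! Suc j = D}"
    by (rule finite_subset[of _ "{..<length w}"]) auto
  then show ?thesis
    unfolding dd_def by (subst card_positions_Cons) (cases w; auto)+
qed

lemma dd_descents: "dd ((if b then D else U) # w) = descents b w"
proof (induction w arbitrary: b)
  case Nil
  then show ?case by (simp add: dd_def)
next
  case (Cons s w)
  then show ?case using Cons.IH[of True] Cons.IH[of False]
    by (cases s) (auto simp: dd_Cons[of _ "_ # _"])
qed

text \<open>The number of non-rightmost peaks whose height satisfies \<open>Q\<close>, in a path that starts at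
  height \<open>h\<close>. It covers both \<open>pk\<close>, with the trivial predicate, and \<open>pk_mod\<close>.\<close>

definition nonrightmost_card :: "nat \<Rightarrow> (int \<Rightarrow> bool) \<Rightarrow> int \<Rightarrow> step list \<Rightarrow> nat" where
  "nonrightmost_card k Q h P = card {j \<in> nonrightmost_peaks P. Q (h + peak_height k P j)}"

lemma Suc_mem_peaks: "Suc j \<in> peaks (s # w) \<longleftrightarrow> j \<in> peaks w"
  by (auto simp: peaks_def)

lemma zero_mem_peaks: "0 \<in> peaks (s # w) \<longleftrightarrow> s = U \<and> w \<noteq> [] \<and> hd w = D"
  by (auto simp: peaks_def hd_conv_nth)

lemma peaks_nonempty: "last w = D \<Longrightarrow> peaks (U # w) \<noteq> {}" if "w \<noteq> []"
  using that
proof (induction w)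
  case (Cons s w)
  show ?case
  proof (cases s)
    case D
    then have "0 \<in> peaks (U # s # w)" by (simp add: peaks_def)
    then show ?thesis by auto
  next
    case U
    then have "w \<noteq> []" using Cons.prems by auto
    then obtain j where "j \<in> peaks (U # w)" using Cons by auto
    then have "Suc j \<in> peaks (U # s # w)" by (simp add: U Suc_mem_peaks)
    then show ?thesis by auto
  qed
qed simp

lemma nonrightmost_card_Cons:
  "nonrightmost_card k Q h (s # w) =
     of_bool (s = U \<and> w \<noteq> [] \<and> hd w = D \<and> peaks w \<noteq> {} \<and> Q (h + 1)) +
     nonrightmost_card k Q (h + snd (step_vec k s)) w"
proof -
  have ph: "peak_height k (s # w) (Suc j) = snd (step_vec k s) + peak_height k w j" for j
    by (simp add: peak_height_def vertex_def)
  have ph0: "peak_height k (U # w) 0 = 1"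
    by (simp add: peak_height_def vertex_def)
  have Suc_nr: "Suc j \<in> nonrightmost_peaks (s # w) \<longleftrightarrow> j \<in> nonrightmost_peaks w" for j
    unfolding nonrightmost_peaks_def
    by (auto simp: Suc_mem_peaks) (metis Suc_lessE Suc_mem_peaks Suc_mono)+
  have zero_nr: "0 \<in> nonrightmost_peaks (s # w) \<longleftrightarrow> s = U \<and> w \<noteq> [] \<and> hd w = D \<and> peaks w \<noteq> {}"
    unfolding nonrightmost_peaks_def
    by (auto simp: zero_mem_peaks) (metis Suc_mem_peaks gr0_implies_Suc empty_iff, metis Suc_mem_peaks zero_less_Suc)
  have "finite (nonrightmost_peaks w)"
    by (rule finite_subset[of _ "{..<length w}"]) (auto simp: nonrightmost_peaks_def peaks_def)
  then show ?thesis
    unfolding nonrightmost_card_def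
    by (subst card_positions_Cons) (auto simp: Suc_nr zero_nr ph ph0 add.assoc)
qed

text \<open>In a word that ends with a down step, each non-rightmost peak is paired with the next valley,
  and the two heights differ by a multiple of \<open>k\<close>. A valley made with the preceding down step
  has no peak of its own in the word, hence the correction in the second part.\<close>

lemma valleys_eq_nonrightmost:
  assumes per: "\<And>h. Q (h - int k) = Q h"
  shows "last (U # w) = D \<Longrightarrow> valleys k Q h False w = nonrightmost_card k Q (h - 1) (U # w)"
    and "last (D # w) = D \<Longrightarrow>
      valleys k Q h True w = nonrightmost_card k Q (h + int k) (D # w) + of_bool (Q h \<and> peaks w \<noteq> {})"
proof (induction w arbitrary: h)
  case Nil
  { case 1 then show ?case by simp }
  { case 2 then show ?case
      by (simp add: nonrightmost_card_def nonrightmost_peaks_def peaks_def) }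
next
  case (Cons s w)
  have DD: "peaks (D # w) \<noteq> {} \<longleftrightarrow> peaks w \<noteq> {}" for w
    by (metis Suc_mem_peaks ex_in_conv not0_implies_Suc step.distinct(1) zero_mem_peaks)
  { case 1
    show ?case
    proof (cases s)
      case U
      then show ?thesis using 1 Cons.IH(1)[of "h + 1"]
        by (auto simp: nonrightmost_card_Cons[of _ _ _ _ "_ # _"])
    next
      case D
      then show ?thesis using 1 Cons.IH(2)[of "h - int k"] per[of h] DD[of w]
        by (auto simp: nonrightmost_card_Cons[of _ _ _ _ "_ # _"])
    qed }
  { case 2
    show ?case
    proof (cases s)
      case U
      then have "peaks (U # w) \<noteq> {}" using 2 peaks_nonempty[of w] by (auto split: if_splits)
      then show ?thesis using U 2 Cons.IH(1)[of "h + 1"]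
        by (auto simp: nonrightmost_card_Cons[of _ _ _ _ "_ # _"])
    next
      case D
      then show ?thesis using 2 Cons.IH(2)[of "h - int k"] per[of h] DD[of w]
        by (auto simp: nonrightmost_card_Cons[of _ _ _ _ "_ # _"])
    qed }
qed

lemma dyck_path_ends:
  assumes "P \<in> dyck_paths k n" "k \<ge> 1" "n \<ge> 1"
  shows "P \<noteq> []" "hd P = U" "last P = D"
proof -
  have ok: "stack_ok k 1 P" and n: "count_list P D = n" using assms by (auto simp: dyck_paths_iff)
  show ne: "P \<noteq> []" using n assms by auto
  then show "hd P = U" using ok assms by (cases P; cases "hd P") auto
  have "\<not> stack_ok k s (w @ [U])" if "s \<ge> 1" for s w
    using that
  proof (induction w arbitrary: s)
    case (Cons a w)
    then show ?case by (cases a) auto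
  qed simp
  then show "last P = D" using ok ne by (metis append_butlast_last_id le_refl step.exhaust)
qed

lemma dyck_path_statistics:
  assumes "P \<in> dyck_paths k n" "k \<ge> 1" "n \<ge> 1"
  shows "dd P = descents False P"
    and "dd P + pk P + 1 = n"
    and "pk_mod k i P = valleys k (\<lambda>h. [h = int i] (mod int k)) 0 False P"
proof -
  note ends = dyck_path_ends[OF assms]
  show dd: "dd P = descents False P"
    using dd_descents[of False P] by (simp add: dd_Cons)
  have nr: "valleys k Q 0 False P = nonrightmost_card k Q 0 P" if "\<And>h. Q (h - int k) = Q h" for Q
    using valleys_eq_nonrightmost(1)[of Q k P 0, OF that] ends by (simp add: nonrightmost_card_Cons)
  show "pk_mod k i P = valleys k (\<lambda>h. [h = int i] (mod int k)) 0 False P"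
    by (subst nr) (auto simp: nonrightmost_card_def pk_mod_def cong_def)
  have "pk P = valleys k (\<lambda>_. True) 0 False P"
    by (subst nr) (auto simp: nonrightmost_card_def pk_def)
  then show "dd P + pk P + 1 = n"
    using valleys_descents[of False P k 0] ends dd assms by (simp add: dyck_paths_iff)
qed

section \<open>The statistics on trees\<close>

text \<open>The number of valleys at heights satisfying \<open>Q\<close>, for a tree whose path starts at height
  \<open>c\<close>, and for the upper part of a stack that lies on \<open>c\<close> further entries. An entry that is not
  the top of the list is followed by an up step, so it ends at a valley unless it is a leaf;
  with \<open>m\<close> entries of the stack up to and including it, this valley has height \<open>m - 1\<close>.\<close>

fun tree_valleys :: "(int \<Rightarrow> bool) \<Rightarrow> nat \<Rightarrow> tree \<Rightarrow> nat"
  and stack_valleys :: "(int \<Rightarrow> bool) \<Rightarrow> nat \<Rightarrow> tree list \<Rightarrow> nat" where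
  "tree_valleys Q c Leaf = 0"
| "tree_valleys Q c (Node ts) = stack_valleys Q c ts"
| "stack_valleys Q c [] = 0"
| "stack_valleys Q c (t # ts) = tree_valleys Q (c + length ts) t + stack_valleys Q c ts +
     of_bool (ts \<noteq> [] \<and> hd ts \<noteq> Leaf \<and> Q (int (c + length ts) - 1))"

text \<open>A down step follows a down step if and only if the top of the stack is not a leaf.\<close>

fun tree_descents :: "tree \<Rightarrow> nat" where
  "tree_descents Leaf = 0"
| "tree_descents (Node ts) =
     sum_list (map tree_descents ts) + of_bool (ts \<noteq> [] \<and> hd ts \<noteq> Leaf)"

lemma stack_valleys_append:
  "stack_valleys Q c (xs @ ys) = stack_valleys Q (c + length ys) xs + stack_valleys Q c ys +
     of_bool (xs \<noteq> [] \<and> ys \<noteq> [] \<and> hd ys \<noteq> Leaf \<and> Q (int (c + length ys) - 1))"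
proof (induction xs)
  case (Cons x xs)
  then show ?case by (cases xs) (auto simp: algebra_simps)
qed simp

lemma foldl_statistics:
  assumes "stack_ok k (length st) w" "st \<noteq> []"
  shows "stack_valleys Q 0 (foldl (tree_step k) st w) =
           stack_valleys Q 0 st + valleys k Q (int (length st) - 1) (hd st \<noteq> Leaf) w"
    and "sum_list (map tree_descents (foldl (tree_step k) st w)) =
           sum_list (map tree_descents st) + descents (hd st \<noteq> Leaf) w"
  using assms
proof (induction w arbitrary: st)
  case (Cons s w)
  { case 1
    define xs ys where "xs = take (Suc k) st" and "ys = drop (Suc k) st"
    have st: "st = xs @ ys" by (simp add: xs_def ys_def)
    show ?case
    proof (cases s)
      case U
      then show ?thesis using 1 Cons.IH(1)[of "Leaf # st"] by simp
    next
      case D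
      have len: "length xs = Suc k" using 1 D by (simp add: xs_def)
      then have "xs \<noteq> []" by auto
      moreover have s: "tree_step k st s = Node xs # ys" by (simp add: D xs_def ys_def)
      ultimately show ?thesis using 1 D Cons.IH(1)[of "Node xs # ys"] len unfolding s foldl.simps
        by (simp add: st Suc_diff_le stack_valleys_append)
    qed }
  { case 2
    define xs ys where "xs = take (Suc k) st" and "ys = drop (Suc k) st"
    have st: "st = xs @ ys" by (simp add: xs_def ys_def)
    show ?case
    proof (cases s)
      case U
      then show ?thesis using 2 Cons.IH(2)[of "Leaf # st"] by simp
    next
      case D
      have len: "length xs = Suc k" using 2 D by (simp add: xs_def)
      then have "xs \<noteq> []" by auto
      moreover have s: "tree_step k st s = Node xs # ys" by (simp add: D xs_def ys_def)
      ultimately show ?thesis using 2 D Cons.IH(2)[of "Node xs # ys"] len unfolding s foldl.simps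
        by (simp add: st Suc_diff_le)
    qed }
qed simp_all

lemma path_tree_statistics:
  assumes "P \<in> dyck_paths k n"
  shows "tree_valleys Q 0 (path_tree k P) = valleys k Q 0 False P"
    and "tree_descents (path_tree k P) = descents False P"
  using foldl_statistics[of k "[Leaf]" P] path_tree(1)[OF assms] assms
  by (auto simp: dyck_paths_iff)

text \<open>The valleys of a node, split into those inside its children and those that its children
  themselves end at; the top child, with index \<open>0\<close>, does not end at a valley.\<close>

lemma stack_valleys_sum:
  "stack_valleys Q c ts =
     (\<Sum>j<length ts. tree_valleys Q (c + length ts - 1 - j) (ts ! j)) +
     (\<Sum>j\<in>{1..<length ts}. of_bool (ts ! j \<noteq> Leaf \<and> Q (int (c + length ts) - 1 - int j)))"
proof (induction ts)
  case (Cons t ts)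
  have "(\<Sum>j\<in>{1..<Suc (length ts)}. of_bool ((t # ts) ! j \<noteq> Leaf \<and> Q (int (c + Suc (length ts)) - 1 - int j)) :: nat)
      = (\<Sum>j\<in>{0..<length ts}. of_bool (ts ! j \<noteq> Leaf \<and> Q (int (c + length ts) - 1 - int j)))"
    unfolding One_nat_def sum.shift_bounds_Suc_ivl by (simp add: algebra_simps)
  also have "\<dots> = of_bool (ts \<noteq> [] \<and> hd ts \<noteq> Leaf \<and> Q (int (c + length ts) - 1)) +
      (\<Sum>j\<in>{1..<length ts}. of_bool (ts ! j \<noteq> Leaf \<and> Q (int (c + length ts) - 1 - int j)))"
    by (cases "ts = []") (simp_all add: sum.atLeast_Suc_lessThan[of 0] hd_conv_nth
      del: sum.op_ivl_Suc sum_of_bool_eq)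
  finally show ?case
    by (simp add: Cons.IH sum.lessThan_Suc_shift del: sum.lessThan_Suc)
qed simp

section \<open>Exchanging the slots\<close>

text \<open>The exchange of the entries at positions \<open>0\<close> and \<open>p\<close>.\<close>

definition list_swap :: "nat \<Rightarrow> 'a list \<Rightarrow> 'a list" where
  "list_swap p xs = xs[0 := xs ! p, p := xs ! 0]"

text \<open>At every node, exchange the top child with the child at index \<open>p c\<close>, where \<open>c\<close> is the
  height at which the path of the node starts in the original tree. The child at index \<open>j\<close> starts
  \<open>length ts - 1 - j\<close> higher.\<close>

function twist :: "(nat \<Rightarrow> nat) \<Rightarrow> nat \<Rightarrow> tree \<Rightarrow> tree" where
  "twist p c Leaf = Leaf"
| "twist p c (Node ts) = Node (list_swap (p c)
     (map (\<lambda>j. twist p (c + length ts - 1 - j) (ts ! j)) [0..<length ts]))"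
  by pat_completeness auto
termination
  by (relation "measure (\<lambda>(p, c, t). size t)")
    (auto simp: less_Suc_eq_le intro!: size_list_estimation' nth_mem)

lemma mset_list_swap: "p < length xs \<Longrightarrow> mset (list_swap p xs) = mset xs"
  unfolding list_swap_def by (rule mset_swap) auto

lemma list_swap_list_swap: "p < length xs \<Longrightarrow> list_swap p (list_swap p xs) = xs"
  by (cases xs; cases p) (auto simp: list_swap_def list_update_swap nth_list_update)

context
  fixes k :: nat and p :: "nat \<Rightarrow> nat"
  assumes slot: "\<And>c. p c \<in> {1..k}"
begin

lemma mset_twist:
  "length ts = Suc k \<Longrightarrow> mset (list_swap (p c)
     (map (\<lambda>j. twist p (c + length ts - 1 - j) (ts ! j)) [0..<length ts])) =
   mset (map (\<lambda>j. twist p (c + length ts - 1 - j) (ts ! j)) [0..<length ts])"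
  using slot[of c] by (intro mset_list_swap) simp

lemma sum_list_twist:
  assumes "length ts = Suc k"
  shows "sum_list (map f (list_swap (p c)
     (map (\<lambda>j. twist p (c + length ts - 1 - j) (ts ! j)) [0..<length ts]))) =
   (\<Sum>j<length ts. f (twist p (c + length ts - 1 - j) (ts ! j)) :: nat)"
proof -
  have "sum_list (map f (list_swap (p c)
     (map (\<lambda>j. twist p (c + length ts - 1 - j) (ts ! j)) [0..<length ts]))) =
     sum_list (map f (map (\<lambda>j. twist p (c + length ts - 1 - j) (ts ! j)) [0..<length ts]))"
    unfolding sum_mset_sum_list[symmetric] mset_map mset_twist[OF assms] ..
  then show ?thesis
    unfolding map_map comp_def interv_sum_list_conv_sum_set_nat by (simp only: set_upt atLeast0LessThan)
qed

lemma wf_twist: "wf_tree k t \<Longrightarrow> wf_tree k (twist p c t)"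
proof (induction t arbitrary: c)
  case (Node ts)
  have "set (list_swap (p c) (map (\<lambda>j. twist p (c + length ts - 1 - j) (ts ! j)) [0..<length ts]))
     = set (map (\<lambda>j. twist p (c + length ts - 1 - j) (ts ! j)) [0..<length ts])"
    using Node.prems by (intro mset_eq_setD mset_twist) simp
  then show ?case using Node by (auto simp: list_swap_def)
qed simp

lemma nodes_twist: "wf_tree k t \<Longrightarrow> nodes (twist p c t) = nodes t"
proof (induction t arbitrary: c)
  case (Node ts)
  have "sum_list (map nodes ts) = (\<Sum>j<length ts. nodes (ts ! j))"
    by (simp add: sum_list_sum_nth atLeast0LessThan)
  also have "\<dots> = (\<Sum>j<length ts. nodes (twist p (c + length ts - 1 - j) (ts ! j)))"
    using Node by simp
  finally show ?case using sum_list_twist[of ts nodes c] Node.prems by simp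
qed simp

lemma twist_eq_Leaf_iff: "twist p c t = Leaf \<longleftrightarrow> t = Leaf"
  by (cases t) auto

lemma twist_inject:
  "wf_tree k t \<Longrightarrow> wf_tree k t' \<Longrightarrow> twist p c t = twist p c t' \<Longrightarrow> t = t'"
proof (induction t arbitrary: c t')
  case Leaf
  then show ?case by (metis twist_eq_Leaf_iff)
next
  case (Node ts)
  obtain us where t': "t' = Node us"
    using Node.prems(3) by (cases t') auto
  have len: "length ts = Suc k" "length us = Suc k" using Node.prems t' by auto
  let ?f = "\<lambda>ts. map (\<lambda>j. twist p (c + length ts - 1 - j) (ts ! j)) [0..<length ts]"
  have "list_swap (p c) (?f ts) = list_swap (p c) (?f us)" using Node.prems(3) t' by simp
  then have "?f ts = ?f us"
    using list_swap_list_swap[of "p c" "?f ts"] list_swap_list_swap[of "p c" "?f us"] slot[of c] len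
    by simp
  then have eq: "twist p (c + k - j) (ts ! j) = twist p (c + k - j) (us ! j)" if "j < Suc k" for j
    using that len by (auto simp: list_eq_iff_nth_eq simp del: upt_Suc)
  have "ts = us"
    using len Node.prems t' by (intro nth_equalityI Node.IH[OF _ _ _ eq]) auto
  then show ?case by (simp add: t')
qed

text \<open>If \<open>p c\<close> is the only slot of a node at height \<open>c\<close> whose valley has a height satisfying
  \<open>Q\<close>, the exchange turns the counted valleys into double descents.\<close>

lemma descents_twist:
  assumes Q: "\<And>c j. j \<in> {1..k} \<Longrightarrow> Q (int (c + k) - int j) \<longleftrightarrow> j = p c"
  shows "wf_tree k t \<Longrightarrow> tree_descents (twist p c t) = tree_valleys Q c t"
proof (induction t arbitrary: c)
  case (Node ts)
  have len: "length ts = Suc k" using Node.prems by simp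
  have p: "p c \<in> {1..k}" by (rule slot)
  let ?us = "map (\<lambda>j. twist p (c + length ts - 1 - j) (ts ! j)) [0..<length ts]"
  have hd: "hd (list_swap (p c) ?us) = twist p (c + k - p c) (ts ! p c)"
    using p len by (subst hd_conv_nth) (auto simp: list_swap_def nth_list_update simp del: upt_Suc)
  have ne: "list_swap (p c) ?us \<noteq> []" using len by (auto simp: list_swap_def)
  have "(\<Sum>j\<in>{1..<length ts}. of_bool (ts ! j \<noteq> Leaf \<and> Q (int (c + length ts) - 1 - int j))) =
     (\<Sum>j\<in>{1..k}. if j = p c then of_bool (ts ! p c \<noteq> Leaf) else (0::nat))"
    using Q[of _ c] by (intro sum.cong) (auto simp: len)
  also have "\<dots> = of_bool (ts ! p c \<noteq> Leaf)" using p by simp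
  finally have "tree_valleys Q c (Node ts) =
     (\<Sum>j<length ts. tree_valleys Q (c + length ts - 1 - j) (ts ! j)) + of_bool (ts ! p c \<noteq> Leaf)"
    by (simp add: stack_valleys_sum)
  also have "\<dots> = (\<Sum>j<length ts. tree_descents (twist p (c + length ts - 1 - j) (ts ! j))) +
     of_bool (ts ! p c \<noteq> Leaf)"
    using Node by simp
  also have "\<dots> = tree_descents (twist p c (Node ts))"
    using ne hd sum_list_twist[OF len, of tree_descents c] by (simp add: twist_eq_Leaf_iff)
  finally show ?case by simp
qed simp

lemma bij_betw_twist: "bij_betw (twist p c) (trees k n) (trees k n)"
proof (intro bij_betw_imageI endo_inj_surj)
  show "finite (trees k n)"
    using bij_betw_finite[OF bij_betw_path_tree] finite_dyck_paths by blast
  show "twist p c ` trees k n \<subseteq> trees k n"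
    by (auto simp: trees_def wf_twist nodes_twist)
  show inj: "inj_on (twist p c) (trees k n)" "inj_on (twist p c) (trees k n)"
    by (auto simp: trees_def inj_on_def dest: twist_inject)
qed

end

section \<open>Equidistribution\<close>

lemma card_filter_bij_betw:
  assumes "bij_betw f A B" "\<And>x. x \<in> A \<Longrightarrow> P x \<longleftrightarrow> R (f x)"
  shows "card {x \<in> A. P x} = card {y \<in> B. R y}"
proof (rule bij_betw_same_card)
  show "bij_betw f {x \<in> A. P x} {y \<in> B. R y}"
    using assms by (auto simp: bij_betw_def inj_on_def)
qed

lemma card_pk_mod_eq_card_dd:
  assumes "k \<ge> 1" "n \<ge> 1" "i < k"
  shows "card {P \<in> dyck_paths k n. pk_mod k i P = r} = card {P \<in> dyck_paths k n. dd P = r}"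
proof -
  \<comment> \<open>The child at index \<open>j\<close> of a node at height \<open>c\<close> ends at height \<open>c + k - j\<close>, so the slot
    counted by \<open>i\<close> is the \<open>j\<close> for which \<open>k - j\<close> is the residue of \<open>i - c\<close>.\<close>
  define Q where "Q = (\<lambda>h. [h = int i] (mod int k))"
  define p where "p = (\<lambda>c::nat. k - nat ((int i - int c) mod int k))"
  have k: "int k > 0" using assms by simp
  have m: "nat ((int i - int c) mod int k) < k" for c :: nat
    using pos_mod_bound[OF k, of "int i - int c"] pos_mod_sign[OF k, of "int i - int c"] by linarith
  have slot: "p c \<in> {1..k}" for c
    using m[of c] by (auto simp: p_def)
  have Q: "Q (int (c + k) - int j) \<longleftrightarrow> j = p c" if j: "j \<in> {1..k}" for c j
  proof -
    have "Q (int (c + k) - int j) \<longleftrightarrow> [int k - int j = int i - int c] (mod int k)"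
      unfolding Q_def cong_iff_dvd_diff by (simp add: algebra_simps)
    also have "\<dots> \<longleftrightarrow> int k - int j = (int i - int c) mod int k"
      unfolding cong_def using j by (subst mod_pos_pos_trivial) auto
    also have "\<dots> \<longleftrightarrow> j = p c"
      using m[of c] j pos_mod_sign[OF k, of "int i - int c"] unfolding p_def by auto
    finally show ?thesis .
  qed
  have twist: "tree_descents (twist p 0 t) = tree_valleys Q 0 t" if "wf_tree k t" for t
    by (rule descents_twist[of p k Q, OF slot Q that])
  note stats = dyck_path_statistics[OF _ assms(1,2)] path_tree_statistics
  have "card {P \<in> dyck_paths k n. pk_mod k i P = r} = card {t \<in> trees k n. tree_valleys Q 0 t = r}"
    by (rule card_filter_bij_betw[OF bij_betw_path_tree]) (simp add: stats Q_def)
  also have "\<dots> = card {t \<in> trees k n. tree_descents t = r}"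
    by (rule card_filter_bij_betw[OF bij_betw_twist[of p k 0 n, OF slot]])
      (simp add: twist trees_def)
  also have "\<dots> = card {P \<in> dyck_paths k n. dd P = r}"
    by (rule card_filter_bij_betw[OF bij_betw_path_tree, symmetric]) (simp add: stats)
  finally show ?thesis .
qed

theorem mainTheorem4:
  fixes k n :: nat
  assumes "k \<ge> 1" and "n \<ge> 1"
  shows "\<forall>st \<in> {pk_mod k i | i. i \<le> k - 1} \<union> {dd}. \<forall>r \<le> n - 1.
           card {P \<in> dyck_paths k n. st P = r} = card {P \<in> dyck_paths k n. pk P = n - 1 - r}"
proof (intro ballI allI impI)
  fix st r
  assume st: "st \<in> {pk_mod k i | i. i \<le> k - 1} \<union> {dd}" and r: "r \<le> n - 1"
  have "card {P \<in> dyck_paths k n. st P = r} = card {P \<in> dyck_paths k n. dd P = r}"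
    using st card_pk_mod_eq_card_dd[OF assms] assms(1) by auto
  also have "{P \<in> dyck_paths k n. dd P = r} = {P \<in> dyck_paths k n. pk P = n - 1 - r}"
    using dyck_path_statistics(2)[OF _ assms] r by fastforce
  finally show "card {P \<in> dyck_paths k n. st P = r} = card {P \<in> dyck_paths k n. pk P = n - 1 - r}" .
qed

end
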